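(* Let $G$ be a Lie group with Lie algebra $\mathfrak g$, $X$ a finite-dimensional vector space and $\rho:G\to GL(X)$ a representation with infinitesimal representation $\rho':\mathfrak g\to\mathfrak{gl}(X)$. On $\mathfrak g^*\times\mathbb R\times X^*$ consider the bracket $$\{f,g\}_{X^*}(\mu,z,\alpha)=\left\langle\mu,\left[\frac{\delta f}{\delta\mu},\frac{\delta g}{\delta\mu}\right]\right\rangle+\left(\left\langle\mu,\frac{\delta f}{\delta\mu}\right\rangle-f\right)\frac{\partial g}{\partial z}-\left(\left\langle\mu,\frac{\delta g}{\delta\mu}\right\rangle-g\right)\frac{\partial f}{\partial z}+\left\langle\alpha,\rho'_{\frac{\delta f}{\delta\mu}}\frac{\delta g}{\delta\alpha}-\rho'_{\frac{\delta g}{\delta\mu}}\frac{\delta f}{\delta\alpha}\right\rangle.$$ Then, for a smooth Hamiltonian function $h$ on $\mathfrak g^*\times\mathbb R\times X^*$, the Hamiltonian equations with respect to the Lie-Poisson-Jacobi bracket $\{\cdot,\cdot\}_{X^*}$ are $$\dot\mu=\operatorname{ad}^*_{\frac{\delta h}{\delta\mu}}\mu-\mu\frac{\partial h}{\partial z}-\mathbf J_X\left(\frac{\delta h}{\delta\alpha},\alpha\right),\qquad\dot z=\left\langle\mu,\frac{\delta h}{\delta\mu}\right\rangle-h(\mu,z,\alpha),\qquad\dot\alpha=-\rho'^*_{\frac{\delta h}{\delta\mu}}(\alpha).$$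
   Context: $\frac{\delta f}{\delta\mu}\in\mathfrak g^{**}\cong\mathfrak g$ and $\frac{\delta f}{\delta\alpha}\in X^{**}\cong X$ are partial derivatives of $f$ with respect to $\mu\in\mathfrak g^*$ and $\alpha\in X^*$. $\operatorname{ad}^*_\xi$ is the dual of $\operatorname{ad}_\xi=[\xi,\cdot]$: $\langle\operatorname{ad}^*_\xi\mu,\eta\rangle=\langle\mu,[\xi,\eta]\rangle$. $\rho'^*$ is defined by $\langle\rho'^*_\eta(\alpha),x\rangle=-\langle\alpha,\rho'_\eta(x)\rangle$, and $\mathbf J_X:X\times X^*\to\mathfrak g^*$ by $\langle\mathbf J_X(x,\alpha),\eta\rangle=\langle\alpha,\rho'_\eta(x)\rangle$. For a Jacobi bracket $\{f,g\}=\Lambda(df,dg)+fE(g)-gE(f)$, here with $E=-\frac{\partial}{\partial z}$, the Hamiltonian vector field of $h$ is $X_h=\Lambda(dh,\cdot)+hE$; the Hamiltonian equations are the equations of its integral curves, equivalently $\dot f=\{h,f\}-f\frac{\partial h}{\partial z}$ along them for every smooth function $f$. *)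

theory Defs
  imports "HOL-Analysis.Analysis" "HOL-Algebra.Group"
begin

text \<open>Finite-dimensional spaces are normed spaces spanned by a finite set; unlike
  \<^class>\<open>euclidean_space\<close> this includes the zero space. The norm only serves to talk about limits
  and derivatives. In finite dimension the dual of \<open>'v\<close> is the type \<open>'v \<Rightarrow>\<^sub>L real\<close>, since every
  linear functional is bounded.\<close>

definition finite_dim :: "'v::real_vector itself \<Rightarrow> bool" where
  "finite_dim _ \<longleftrightarrow> (\<exists>B::'v set. finite B \<and> span B = UNIV)"

text \<open>\<open>Ck_on k S f\<close> is only meant for open \<open>S\<close> in a finite-dimensional space, where it is the usual
  notion of a \<open>k\<close> times continuously differentiable map.\<close>

primrec Ck_on :: "nat \<Rightarrow> 'a::real_normed_vector set \<Rightarrow> ('a \<Rightarrow> 'b::real_normed_vector) \<Rightarrow> bool" where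
  "Ck_on 0 S f \<longleftrightarrow> continuous_on S f"
| "Ck_on (Suc k) S f \<longleftrightarrow> (\<forall>x\<in>S. f differentiable (at x)) \<and>
     (\<forall>v. Ck_on k S (\<lambda>x. frechet_derivative f (at x) v))"

definition smooth_on :: "'a::real_normed_vector set \<Rightarrow> ('a \<Rightarrow> 'b::real_normed_vector) \<Rightarrow> bool" where
  "smooth_on S f \<longleftrightarrow> (\<forall>k. Ck_on k S f)"

type_synonym ('m, 'e) chart = "'m set \<times> ('m \<Rightarrow> 'e)"

definition is_chart :: "'m topology \<Rightarrow> ('m, 'e::real_normed_vector) chart \<Rightarrow> bool" where
  "is_chart T = (\<lambda>(U, \<phi>). openin T U \<and> open (\<phi> ` U) \<and>
     homeomorphic_map (subtopology T U) (top_of_set (\<phi> ` U)) \<phi>)"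

definition smooth_atlas :: "'m topology \<Rightarrow> ('m, 'e::real_normed_vector) chart set \<Rightarrow> bool" where
  "smooth_atlas T A \<longleftrightarrow> (\<forall>c\<in>A. is_chart T c) \<and> \<Union>(fst ` A) = topspace T \<and>
     (\<forall>(U, \<phi>)\<in>A. \<forall>(V, \<psi>)\<in>A. smooth_on (\<phi> ` (U \<inter> V)) (\<psi> \<circ> inv_into U \<phi>))"

definition smooth_manifold :: "'m topology \<Rightarrow> ('m, 'e::real_normed_vector) chart set \<Rightarrow> bool" where
  "smooth_manifold T A \<longleftrightarrow> finite_dim TYPE('e) \<and> Hausdorff_space T \<and> second_countable T \<and>
     smooth_atlas T A"

definition product_atlas ::
  "('m, 'e) chart set \<Rightarrow> ('n, 'd) chart set \<Rightarrow> ('m \<times> 'n, 'e \<times> 'd) chart set" where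
  "product_atlas A B = (\<lambda>((U, \<phi>), (V, \<psi>)). (U \<times> V, map_prod \<phi> \<psi>)) ` (A \<times> B)"

definition vector_space_atlas :: "('v, 'v) chart set" where
  "vector_space_atlas = {(UNIV, id)}"

definition smooth_map ::
  "'m topology \<Rightarrow> ('m, 'e::real_normed_vector) chart set \<Rightarrow>
   'n topology \<Rightarrow> ('n, 'd::real_normed_vector) chart set \<Rightarrow> ('m \<Rightarrow> 'n) \<Rightarrow> bool" where
  "smooth_map T A T' A' f \<longleftrightarrow> continuous_map T T' f \<and>
     (\<forall>(U, \<phi>)\<in>A. \<forall>(V, \<psi>)\<in>A'. smooth_on (\<phi> ` {p \<in> U. f p \<in> V}) (\<psi> \<circ> f \<circ> inv_into U \<phi>))"

text \<open>A manifold is a subset \<open>topspace T\<close> of its type. A function on it is represented by the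
  function on the whole type that is \<open>0\<close> elsewhere.\<close>

definition zero_ext :: "'m set \<Rightarrow> ('m \<Rightarrow> real) \<Rightarrow> 'm \<Rightarrow> real" where
  "zero_ext S f = (\<lambda>p. if p \<in> S then f p else 0)"

definition smooth_functions ::
  "'m topology \<Rightarrow> ('m, 'e::real_normed_vector) chart set \<Rightarrow> ('m \<Rightarrow> real) set" where
  "smooth_functions T A = {f. smooth_map T A euclidean vector_space_atlas f \<and>
     (\<forall>p. p \<notin> topspace T \<longrightarrow> f p = 0)}"

text \<open>Smooth vector fields are the derivations of the algebra of smooth functions. The value at
  non-smooth arguments is fixed to \<open>0\<close>, so that equality of vector fields is equality in HOL.\<close>

definition vector_fields ::
  "'m topology \<Rightarrow> ('m, 'e::real_normed_vector) chart set \<Rightarrow> (('m \<Rightarrow> real) \<Rightarrow> ('m \<Rightarrow> real)) set" where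
  "vector_fields T A = {D.
     (\<forall>f\<in>smooth_functions T A. D f \<in> smooth_functions T A) \<and>
     (\<forall>f. f \<notin> smooth_functions T A \<longrightarrow> D f = (\<lambda>p. 0)) \<and>
     (\<forall>f\<in>smooth_functions T A. \<forall>g\<in>smooth_functions T A. \<forall>a b.
        D (\<lambda>p. a * f p + b * g p) = (\<lambda>p. a * D f p + b * D g p)) \<and>
     (\<forall>f\<in>smooth_functions T A. \<forall>g\<in>smooth_functions T A.
        D (\<lambda>p. f p * g p) = (\<lambda>p. f p * D g p + g p * D f p))}"

definition vf_commutator ::
  "(('m \<Rightarrow> real) \<Rightarrow> ('m \<Rightarrow> real)) \<Rightarrow> (('m \<Rightarrow> real) \<Rightarrow> ('m \<Rightarrow> real)) \<Rightarrow> ('m \<Rightarrow> real) \<Rightarrow> ('m \<Rightarrow> real)" where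
  "vf_commutator D D' = (\<lambda>f p. D (D' f) p - D' (D f) p)"

locale lie_group = group G for G :: "('m, 'b) monoid_scheme" (structure) +
  fixes T :: "'m topology" and A :: "('m, 'e::real_normed_vector) chart set"
  assumes topspace_eq: "topspace T = carrier G"
    and manifold: "smooth_manifold T A"
    and smooth_mult:
      "smooth_map (prod_topology T T) (product_atlas A A) T A (\<lambda>(x, y). x \<otimes> y)"
    and smooth_inv: "smooth_map T A T A (\<lambda>x. inv x)"

definition left_invariant_fields ::
  "('m, 'b) monoid_scheme \<Rightarrow> 'm topology \<Rightarrow> ('m, 'e::real_normed_vector) chart set \<Rightarrow>
   (('m \<Rightarrow> real) \<Rightarrow> ('m \<Rightarrow> real)) set" where
  "left_invariant_fields G T A = {D \<in> vector_fields T A.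
     \<forall>x\<in>carrier G. \<forall>f\<in>smooth_functions T A.
       D (zero_ext (carrier G) (\<lambda>p. f (x \<otimes>\<^bsub>G\<^esub> p))) = zero_ext (carrier G) (\<lambda>p. D f (x \<otimes>\<^bsub>G\<^esub> p))}"

text \<open>\<open>('g, lb)\<close> is the Lie algebra of the Lie group, where \<open>\<Xi>\<close> is the linear isomorphism that sends
  an element of \<open>'g\<close> to the corresponding left-invariant vector field.\<close>

definition lie_algebra_of ::
  "('m, 'b) monoid_scheme \<Rightarrow> 'm topology \<Rightarrow> ('m, 'e::real_normed_vector) chart set \<Rightarrow>
   ('g::real_normed_vector \<Rightarrow> 'g \<Rightarrow> 'g) \<Rightarrow> ('g \<Rightarrow> ('m \<Rightarrow> real) \<Rightarrow> ('m \<Rightarrow> real)) \<Rightarrow> bool" where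
  "lie_algebra_of G T A lb \<Xi> \<longleftrightarrow>
     finite_dim TYPE('g) \<and>
     bij_betw \<Xi> UNIV (left_invariant_fields G T A) \<and>
     (\<forall>a b \<xi> \<eta> f p. \<Xi> (a *\<^sub>R \<xi> + b *\<^sub>R \<eta>) f p = a * \<Xi> \<xi> f p + b * \<Xi> \<eta> f p) \<and>
     (\<forall>\<xi> \<eta>. \<Xi> (lb \<xi> \<eta>) = vf_commutator (\<Xi> \<xi>) (\<Xi> \<eta>))"

definition GL :: "('x::real_normed_vector \<Rightarrow>\<^sub>L 'x) monoid" where
  "GL = \<lparr>carrier = {B. \<exists>C. B o\<^sub>L C = id_blinfun \<and> C o\<^sub>L B = id_blinfun},
         mult = (o\<^sub>L), one = id_blinfun\<rparr>"

definition lie_group_representation ::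
  "('m, 'b) monoid_scheme \<Rightarrow> 'm topology \<Rightarrow> ('m, 'e::real_normed_vector) chart set \<Rightarrow>
   ('m \<Rightarrow> ('x::real_normed_vector \<Rightarrow>\<^sub>L 'x)) \<Rightarrow> bool" where
  "lie_group_representation G T A \<rho> \<longleftrightarrow>
     \<rho> \<in> hom G GL \<and> smooth_map T A euclidean vector_space_atlas \<rho>"

text \<open>\<open>\<rho>'\<close> is the tangent map of \<open>\<rho>\<close> at the identity: the tangent vector \<open>\<Xi> \<xi>\<close> at the identity is
  applied to the \<open>'x \<Rightarrow>\<^sub>L 'x\<close>-valued function \<open>\<rho>\<close>, which is done after composition with each
  linear functional \<open>a\<close> on \<open>'x \<Rightarrow>\<^sub>L 'x\<close>.\<close>

definition infinitesimal_representation ::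
  "('m, 'b) monoid_scheme \<Rightarrow> ('g \<Rightarrow> ('m \<Rightarrow> real) \<Rightarrow> ('m \<Rightarrow> real)) \<Rightarrow>
   ('m \<Rightarrow> ('x::real_normed_vector \<Rightarrow>\<^sub>L 'x)) \<Rightarrow> ('g \<Rightarrow> ('x \<Rightarrow>\<^sub>L 'x)) \<Rightarrow> bool" where
  "infinitesimal_representation G \<Xi> \<rho> \<rho>' \<longleftrightarrow>
     (\<forall>\<xi>. \<forall>a :: ('x \<Rightarrow>\<^sub>L 'x) \<Rightarrow>\<^sub>L real.
        blinfun_apply a (\<rho>' \<xi>) =
        \<Xi> \<xi> (zero_ext (carrier G) (\<lambda>p. blinfun_apply a (\<rho> p))) \<one>\<^bsub>G\<^esub>)"

definition ad_star ::
  "('g::real_normed_vector \<Rightarrow> 'g \<Rightarrow> 'g) \<Rightarrow> 'g \<Rightarrow> ('g \<Rightarrow>\<^sub>L real) \<Rightarrow> ('g \<Rightarrow>\<^sub>L real)" where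
  "ad_star lb \<xi> \<mu> = Blinfun (\<lambda>\<eta>. blinfun_apply \<mu> (lb \<xi> \<eta>))"

definition rho_star ::
  "('g \<Rightarrow> ('x::real_normed_vector \<Rightarrow>\<^sub>L 'x)) \<Rightarrow> 'g \<Rightarrow> ('x \<Rightarrow>\<^sub>L real) \<Rightarrow> ('x \<Rightarrow>\<^sub>L real)" where
  "rho_star \<rho>' \<eta> \<alpha> = - (\<alpha> o\<^sub>L \<rho>' \<eta>)"

definition J_map ::
  "('g::real_normed_vector \<Rightarrow> ('x::real_normed_vector \<Rightarrow>\<^sub>L 'x)) \<Rightarrow> 'x \<Rightarrow> ('x \<Rightarrow>\<^sub>L real) \<Rightarrow> ('g \<Rightarrow>\<^sub>L real)" where
  "J_map \<rho>' x \<alpha> = Blinfun (\<lambda>\<eta>. blinfun_apply \<alpha> (blinfun_apply (\<rho>' \<eta>) x))"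

definition differential :: "('p::real_normed_vector \<Rightarrow> real) \<Rightarrow> 'p \<Rightarrow> ('p \<Rightarrow>\<^sub>L real)" where
  "differential f p = Blinfun (frechet_derivative f (at p))"

definition is_jacobi_bivector ::
  "(('p::real_normed_vector \<Rightarrow> real) \<Rightarrow> ('p \<Rightarrow> real) \<Rightarrow> 'p \<Rightarrow> real) \<Rightarrow> ('p \<Rightarrow> 'p) \<Rightarrow>
   ('p \<Rightarrow> ('p \<Rightarrow>\<^sub>L real) \<Rightarrow> ('p \<Rightarrow>\<^sub>L real) \<Rightarrow> real) \<Rightarrow> bool" where
  "is_jacobi_bivector br E \<Lambda> \<longleftrightarrow>
     (\<forall>p. bilinear (\<Lambda> p) \<and> (\<forall>\<beta> \<gamma>. \<Lambda> p \<beta> \<gamma> = - \<Lambda> p \<gamma> \<beta>)) \<and>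
     (\<forall>f g p. smooth_on UNIV f \<longrightarrow> smooth_on UNIV g \<longrightarrow>
        br f g p = \<Lambda> p (differential f p) (differential g p)
          + f p * blinfun_apply (differential g p) (E p)
          - g p * blinfun_apply (differential f p) (E p))"

text \<open>The bivector is determined by the bracket and \<open>E\<close>, because every covector is a differential.\<close>

definition jacobi_bivector ::
  "(('p::real_normed_vector \<Rightarrow> real) \<Rightarrow> ('p \<Rightarrow> real) \<Rightarrow> 'p \<Rightarrow> real) \<Rightarrow> ('p \<Rightarrow> 'p) \<Rightarrow>
   'p \<Rightarrow> ('p \<Rightarrow>\<^sub>L real) \<Rightarrow> ('p \<Rightarrow>\<^sub>L real) \<Rightarrow> real" where
  "jacobi_bivector br E = (THE \<Lambda>. is_jacobi_bivector br E \<Lambda>)"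

text \<open>\<open>X\<^sub>h = \<Lambda>(dh, \<cdot>) + h E\<close>, as a vector identified by its pairing with all covectors.\<close>

definition hamiltonian_vector_field ::
  "(('p::real_normed_vector \<Rightarrow> real) \<Rightarrow> ('p \<Rightarrow> real) \<Rightarrow> 'p \<Rightarrow> real) \<Rightarrow> ('p \<Rightarrow> 'p) \<Rightarrow>
   ('p \<Rightarrow> real) \<Rightarrow> 'p \<Rightarrow> 'p" where
  "hamiltonian_vector_field br E h p = (THE v. \<forall>\<beta>.
     blinfun_apply \<beta> v =
     jacobi_bivector br E p (differential h p) \<beta> + h p * blinfun_apply \<beta> (E p))"

definition is_integral_curve :: "('p::real_normed_vector \<Rightarrow> 'p) \<Rightarrow> real set \<Rightarrow> (real \<Rightarrow> 'p) \<Rightarrow> bool" where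
  "is_integral_curve X I c \<longleftrightarrow> (\<forall>t\<in>I. (c has_vector_derivative X (c t)) (at t))"

text \<open>The derivative of a function on the dual of \<open>'v\<close>, as an element of the bidual, is evaluation at
  a unique vector of \<open>'v\<close>.\<close>

definition dual_gradient :: "(('v::real_normed_vector \<Rightarrow>\<^sub>L real) \<Rightarrow> real) \<Rightarrow> ('v \<Rightarrow>\<^sub>L real) \<Rightarrow> 'v" where
  "dual_gradient F \<mu> = (THE \<xi>. \<forall>\<nu>. frechet_derivative F (at \<mu>) \<nu> = blinfun_apply \<nu> \<xi>)"

type_synonym ('g, 'x) lpj_space = "('g \<Rightarrow>\<^sub>L real) \<times> real \<times> ('x \<Rightarrow>\<^sub>L real)"

definition d_mu ::
  "(('g::real_normed_vector, 'x::real_normed_vector) lpj_space \<Rightarrow> real) \<Rightarrow> ('g, 'x) lpj_space \<Rightarrow> 'g" where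
  "d_mu f = (\<lambda>(\<mu>, z, \<alpha>). dual_gradient (\<lambda>\<mu>'. f (\<mu>', z, \<alpha>)) \<mu>)"

definition d_z ::
  "(('g::real_normed_vector, 'x::real_normed_vector) lpj_space \<Rightarrow> real) \<Rightarrow> ('g, 'x) lpj_space \<Rightarrow> real" where
  "d_z f = (\<lambda>(\<mu>, z, \<alpha>). deriv (\<lambda>z'. f (\<mu>, z', \<alpha>)) z)"

definition d_alpha ::
  "(('g::real_normed_vector, 'x::real_normed_vector) lpj_space \<Rightarrow> real) \<Rightarrow> ('g, 'x) lpj_space \<Rightarrow> 'x" where
  "d_alpha f = (\<lambda>(\<mu>, z, \<alpha>). dual_gradient (\<lambda>\<alpha>'. f (\<mu>, z, \<alpha>')) \<alpha>)"

definition lpj_bracket ::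
  "('g::real_normed_vector \<Rightarrow> 'g \<Rightarrow> 'g) \<Rightarrow> ('g \<Rightarrow> ('x::real_normed_vector \<Rightarrow>\<^sub>L 'x)) \<Rightarrow>
   (('g, 'x) lpj_space \<Rightarrow> real) \<Rightarrow> (('g, 'x) lpj_space \<Rightarrow> real) \<Rightarrow> ('g, 'x) lpj_space \<Rightarrow> real" where
  "lpj_bracket lb \<rho>' f g = (\<lambda>(\<mu>, z, \<alpha>). let p = (\<mu>, z, \<alpha>) in
     blinfun_apply \<mu> (lb (d_mu f p) (d_mu g p))
     + (blinfun_apply \<mu> (d_mu f p) - f p) * d_z g p
     - (blinfun_apply \<mu> (d_mu g p) - g p) * d_z f p
     + blinfun_apply \<alpha> (blinfun_apply (\<rho>' (d_mu f p)) (d_alpha g p)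
                        - blinfun_apply (\<rho>' (d_mu g p)) (d_alpha f p)))"

text \<open>The vector field \<open>E = - \<partial>/\<partial>z\<close>.\<close>

definition lpj_E ::
  "('g::real_normed_vector, 'x::real_normed_vector) lpj_space \<Rightarrow> ('g, 'x) lpj_space" where
  "lpj_E p = (0, -1, 0)"

end

theory Submission
  imports Defs
begin

text \<open>The bracket at a point depends on \<open>f\<close> and \<open>g\<close> only through their values and differentials, and
  its part bilinear in the differentials is a skew form; linear functions realise every covector, so
  this form is the only bivector compatible with \<open>E\<close>. Pairing \<open>\<Lambda>(dh, \<cdot>) + h E\<close> with an arbitrary
  covector and reading off its coefficients gives the three equations. Skewness and bilinearity of the
  Lie bracket and linearity of \<open>\<rho>'\<close> come from commutators of derivations. Since \<open>'g\<close> and \<open>'x\<close>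
  carry arbitrary norms, automatic continuity of linear maps and reflexivity are needed for
  finite-dimensional normed spaces; both rest on the completeness of finitely spanned subspaces.\<close>

section \<open>Finite-dimensional normed spaces\<close>

text \<open>Factoring out \<open>t\<close> writes the vector as \<open>t\<close> times the
  difference of \<open>a\<close> and a point of \<open>S\<close>. When \<open>a\<close> has positive
  distance from \<open>S\<close>, the norm therefore controls the coefficient of
  \<open>a\<close>.\<close>

lemma norm_add_scaleR_ge_infdist:
  fixes a :: "'v::real_normed_vector"
  assumes S: "subspace S" and s: "s \<in> S"
  shows "\<bar>t\<bar> * infdist a S \<le> norm (s + t *\<^sub>R a)"
proof (cases "t = 0")
  case False
  have "- (s /\<^sub>R t) \<in> S"
    using S s by (simp add: subspace_neg subspace_scale)
  then have "infdist a S \<le> dist a (- (s /\<^sub>R t))"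
    by (rule infdist_le)
  then have "\<bar>t\<bar> * infdist a S \<le> \<bar>t\<bar> * norm (a + s /\<^sub>R t)"
    by (simp add: dist_norm mult_left_mono)
  also have "\<dots> = norm (t *\<^sub>R (a + s /\<^sub>R t))"
    by simp
  also have "t *\<^sub>R (a + s /\<^sub>R t) = s + t *\<^sub>R a"
    using False by (simp add: scaleR_add_right)
  finally show ?thesis .
qed simp

lemma Cauchy_diff:
  fixes X Y :: "nat \<Rightarrow> 'v::real_normed_vector"
  assumes "Cauchy X" "Cauchy Y"
  shows "Cauchy (\<lambda>n. X n - Y n)"
  unfolding Cauchy_iff
proof (intro allI impI)
  fix e :: real
  assume "e > 0"
  then have "e / 2 > 0" by simp
  then obtain M N
    where "\<forall>m\<ge>M. \<forall>n\<ge>M. norm (X m - X n) < e / 2" "\<forall>m\<ge>N. \<forall>n\<ge>N. norm (Y m - Y n) < e / 2"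
    using assms unfolding Cauchy_iff by meson
  then have bounds: "norm (X m - X n) < e / 2" "norm (Y m - Y n) < e / 2"
    if "m \<ge> max M N" "n \<ge> max M N" for m n
    using that by auto
  have "norm ((X m - Y m) - (X n - Y n)) < e" if "m \<ge> max M N" "n \<ge> max M N" for m n
  proof -
    have "norm ((X m - Y m) - (X n - Y n)) = norm ((X m - X n) - (Y m - Y n))"
      by (simp add: algebra_simps)
    also have "\<dots> \<le> norm (X m - X n) + norm (Y m - Y n)"
      by (rule norm_triangle_ineq4)
    finally show ?thesis using bounds[OF that] by linarith
  qed
  then show "\<exists>M. \<forall>m\<ge>M. \<forall>n\<ge>M. norm ((X m - Y m) - (X n - Y n)) < e" by blast
qed

text \<open>Induction on the generators. A new generator \<open>a\<close> outside
  \<open>span B\<close> has positive distance from it, because a complete set is closed. So the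
  coefficients of \<open>a\<close> along a Cauchy sequence are Cauchy and converge, and what remains
  is a Cauchy sequence in \<open>span B\<close>.\<close>

lemma complete_span_finite:
  fixes B :: "'v::real_normed_vector set"
  assumes "finite B"
  shows "complete (span B)"
  using assms
proof (induction B rule: finite_induct)
  case empty
  then show ?case by (simp add: compact_imp_complete)
next
  case (insert a B)
  show ?case
  proof (cases "a \<in> span B")
    case True
    then show ?thesis using insert.IH by (simp add: span_redundant)
  next
    case False
    define d where "d = infdist a (span B)"
    have "closed (span B)" "span B \<noteq> {}"
      using insert.IH span_zero by (auto intro: complete_imp_closed)
    with False have d: "d > 0"
      unfolding d_def by (metis in_closed_iff_infdist_zero infdist_nonneg less_eq_real_def)
    show ?thesis
      unfolding complete_def
    proof (intro allI impI)
      fix x :: "nat \<Rightarrow> 'v"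
      assume x: "(\<forall>n. x n \<in> span (insert a B)) \<and> Cauchy x"
      then have "\<forall>n. \<exists>k. x n - k *\<^sub>R a \<in> span B"
        by (simp add: span_breakdown_eq)
      then obtain k where k: "\<And>n. x n - k n *\<^sub>R a \<in> span B"
        by metis
      have bound: "\<bar>k m - k n\<bar> * d \<le> norm (x m - x n)" for m n
      proof -
        \<comment> \<open>The remainders stay in \<open>span B\<close>, so the distance estimate
          applies to \<open>x m - x n\<close> with coefficient \<open>k m - k n\<close>.\<close>
        have "(x m - k m *\<^sub>R a) - (x n - k n *\<^sub>R a) \<in> span B"
          by (intro span_diff k)
        from norm_add_scaleR_ge_infdist[OF subspace_span this, of "k m - k n" a]
        show ?thesis by (simp add: d_def algebra_simps)
      qed
      have "Cauchy k"
        unfolding Cauchy_iff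
      proof (intro allI impI)
        fix e :: real
        assume "e > 0"
        then have "e * d > 0" using d by simp
        then obtain M where M: "\<And>m n. m \<ge> M \<Longrightarrow> n \<ge> M \<Longrightarrow> norm (x m - x n) < e * d"
          using x unfolding Cauchy_iff by meson
        have "norm (k m - k n) < e" if "m \<ge> M" "n \<ge> M" for m n
          using bound[of m n] M[OF that] d by (smt (verit) mult_right_less_imp_less real_norm_def)
        then show "\<exists>M. \<forall>m\<ge>M. \<forall>n\<ge>M. norm (k m - k n) < e" by blast
      qed
      then obtain l where l: "k \<longlonglongrightarrow> l"
        using Cauchy_convergent convergent_def by blast
      then have ka: "(\<lambda>n. k n *\<^sub>R a) \<longlonglongrightarrow> l *\<^sub>R a"
        by (intro tendsto_intros)
      have "Cauchy (\<lambda>n. x n - k n *\<^sub>R a)"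
        using x ka by (intro Cauchy_diff) (auto intro: LIMSEQ_imp_Cauchy)
      with k obtain s where s: "s \<in> span B" "(\<lambda>n. x n - k n *\<^sub>R a) \<longlonglongrightarrow> s"
        using insert.IH unfolding complete_def by meson
      from tendsto_add[OF s(2) ka] have "x \<longlonglongrightarrow> s + l *\<^sub>R a" by simp
      moreover have "s + l *\<^sub>R a \<in> span (insert a B)"
        using s(1) by (auto simp: span_breakdown_eq intro!: exI[of _ l])
      ultimately show "\<exists>l\<in>span (insert a B). x \<longlonglongrightarrow> l" by blast
    qed
  qed
qed

section \<open>Bases, automatic continuity and reflexivity\<close>

lemma finite_dim_obtain_basis:
  assumes "finite_dim TYPE('v)"
  obtains B :: "'v::real_vector set" where "finite B" "independent B" "span B = UNIV"
proof -
  obtain C :: "'v set" where C: "finite C" "span C = UNIV"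
    using assms unfolding finite_dim_def by blast
  obtain B where "B \<subseteq> C" "independent B" "C \<subseteq> span B"
    by (rule maximal_independent_subset)
  moreover from this(3) have "span B = UNIV"
    using C(2) by (metis span_minimal subspace_span top.extremum_uniqueI)
  ultimately show thesis
    using C(1) that by (blast intro: finite_subset)
qed

lemma sum_representation_UNIV:
  fixes B :: "'v::real_vector set"
  assumes "finite B" "independent B" "span B = UNIV"
  shows "(\<Sum>b\<in>B. representation B v b *\<^sub>R b) = v"
  using assms by (intro real_vector.sum_representation_eq) auto

text \<open>The span of the other basis vectors is closed by completeness and misses
  \<open>b\<close> by independence. The inverse of the distance from \<open>b\<close> to it bounds
  the coordinate.\<close>

lemma bounded_linear_representation:
  fixes B :: "'v::real_normed_vector set"
  assumes B: "finite B" "independent B" "span B = UNIV" and b: "b \<in> B"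
  shows "bounded_linear (\<lambda>v. representation B v b)"
proof -
  define S where "S = span (B - {b})"
  have "closed S"
    unfolding S_def using B(1) by (intro complete_imp_closed complete_span_finite) simp
  moreover have "S \<noteq> {}"
    unfolding S_def using span_zero by blast
  moreover have "b \<notin> S"
    using B(2) b unfolding S_def dependent_def by blast
  ultimately have d: "infdist b S > 0"
    by (metis in_closed_iff_infdist_zero infdist_nonneg less_eq_real_def)
  show ?thesis
  proof (rule bounded_linear_intro)
    show "representation B (v + w) b = representation B v b + representation B w b" for v w
      using B by (simp add: real_vector.representation_add)
    show "representation B (r *\<^sub>R v) b = r *\<^sub>R representation B v b" for r v
      using B by (simp add: real_vector.representation_scale)
    fix v
    let ?s = "\<Sum>c\<in>B - {b}. representation B v c *\<^sub>R c"
    have "?s \<in> S"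
      unfolding S_def by (intro span_sum span_scale span_base)
    moreover have "v = ?s + representation B v b *\<^sub>R b"
      using sum_representation_UNIV[OF B, of v] B(1) b by (simp add: sum.remove add.commute)
    ultimately have "\<bar>representation B v b\<bar> * infdist b S \<le> norm v"
      using norm_add_scaleR_ge_infdist[of S ?s "representation B v b" b]
      unfolding S_def by (metis subspace_span)
    then show "norm (representation B v b) \<le> norm v * (1 / infdist b S)"
      using d by (simp add: field_simps)
  qed
qed

text \<open>In a basis, \<open>f\<close> is a finite sum of bounded coordinates times fixed
  vectors.\<close>

lemma finite_dim_linear_imp_bounded_linear:
  fixes f :: "'v::real_normed_vector \<Rightarrow> 'w::real_normed_vector"
  assumes "finite_dim TYPE('v)" and f: "linear f"
  shows "bounded_linear f"
proof -
  obtain B :: "'v set" where B: "finite B" "independent B" "span B = UNIV"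
    using assms(1) by (rule finite_dim_obtain_basis)
  have "bounded_linear (\<lambda>v. \<Sum>b\<in>B. representation B v b *\<^sub>R f b)"
    by (intro bounded_linear_sum bounded_linear_scaleR_const bounded_linear_representation B)
  also have "(\<lambda>v. \<Sum>b\<in>B. representation B v b *\<^sub>R f b) = f"
  proof
    fix v
    have "(\<Sum>b\<in>B. representation B v b *\<^sub>R f b) = f (\<Sum>b\<in>B. representation B v b *\<^sub>R b)"
      using f by (simp add: linear_sum linear_scale)
    then show "(\<Sum>b\<in>B. representation B v b *\<^sub>R f b) = f v"
      by (simp add: sum_representation_UNIV[OF B])
  qed
  finally show ?thesis .
qed

text \<open>The coordinate functionals of a basis are bounded and already separate points.\<close>

lemma finite_dim_dual_separates:
  fixes v w :: "'v::real_normed_vector"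
  assumes "finite_dim TYPE('v)" and eq: "\<And>\<nu> :: 'v \<Rightarrow>\<^sub>L real. blinfun_apply \<nu> v = blinfun_apply \<nu> w"
  shows "v = w"
proof -
  obtain B :: "'v set" where B: "finite B" "independent B" "span B = UNIV"
    using assms(1) by (rule finite_dim_obtain_basis)
  have "representation B v b = representation B w b" if "b \<in> B" for b
    using eq[of "Blinfun (\<lambda>v. representation B v b)"] bounded_linear_representation[OF B that]
    by (simp add: bounded_linear_Blinfun_apply)
  then have "(\<Sum>b\<in>B. representation B v b *\<^sub>R b) = (\<Sum>b\<in>B. representation B w b *\<^sub>R b)"
    by simp
  then show ?thesis by (simp add: sum_representation_UNIV[OF B])
qed

text \<open>This justifies the definite description in \<open>dual_gradient\<close>. Existence uses
  the dual basis, uniqueness the separation of points by functionals.\<close>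

lemma finite_dim_reflexive:
  fixes F :: "('v::real_normed_vector \<Rightarrow>\<^sub>L real) \<Rightarrow> real"
  assumes fin: "finite_dim TYPE('v)" and F: "linear F"
  shows "\<exists>!\<xi>. \<forall>\<nu>. F \<nu> = blinfun_apply \<nu> \<xi>"
proof -
  obtain B :: "'v set" where B: "finite B" "independent B" "span B = UNIV"
    using fin by (rule finite_dim_obtain_basis)
  define e where "e b = Blinfun (\<lambda>v. representation B v b)" for b
  have e: "blinfun_apply (e b) v = representation B v b" if "b \<in> B" for b v
    using bounded_linear_representation[OF B that] by (simp add: e_def bounded_linear_Blinfun_apply)
  \<comment> \<open>The value of \<open>F\<close> on the dual basis functional \<open>e b\<close>
    has to be the \<open>b\<close>-coordinate of the representing vector.\<close>
  define \<xi> where "\<xi> = (\<Sum>b\<in>B. F (e b) *\<^sub>R b)"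
  have "F \<nu> = blinfun_apply \<nu> \<xi>" for \<nu>
  proof -
    have "blinfun_apply \<nu> v = blinfun_apply (\<Sum>b\<in>B. blinfun_apply \<nu> b *\<^sub>R e b) v" for v
    proof -
      have "blinfun_apply \<nu> v = blinfun_apply \<nu> (\<Sum>b\<in>B. representation B v b *\<^sub>R b)"
        by (simp add: sum_representation_UNIV[OF B])
      also have "\<dots> = (\<Sum>b\<in>B. representation B v b * blinfun_apply \<nu> b)"
        by (simp add: blinfun.sum_right blinfun.scaleR_right)
      also have "\<dots> = blinfun_apply (\<Sum>b\<in>B. blinfun_apply \<nu> b *\<^sub>R e b) v"
        by (simp add: blinfun.sum_left blinfun.scaleR_left e mult.commute)
      finally show ?thesis .
    qed
    then have "\<nu> = (\<Sum>b\<in>B. blinfun_apply \<nu> b *\<^sub>R e b)"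
      by (rule blinfun_eqI)
    then have "F \<nu> = F (\<Sum>b\<in>B. blinfun_apply \<nu> b *\<^sub>R e b)"
      by simp
    also have "\<dots> = (\<Sum>b\<in>B. blinfun_apply \<nu> b * F (e b))"
      using F by (simp add: linear_sum linear_scale)
    also have "\<dots> = blinfun_apply \<nu> \<xi>"
      by (simp add: \<xi>_def blinfun.sum_right blinfun.scaleR_right mult.commute)
    finally show ?thesis .
  qed
  moreover have "\<xi>1 = \<xi>2"
    if "\<forall>\<nu>. F \<nu> = blinfun_apply \<nu> \<xi>1" "\<forall>\<nu>. F \<nu> = blinfun_apply \<nu> \<xi>2" for \<xi>1 \<xi>2
    using that by (intro finite_dim_dual_separates[OF fin]) metis
  ultimately show ?thesis by blast
qed

text \<open>Inverse of the canonical embedding of \<open>'v\<close> into its bidual. It gives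
  gradients and covector components a common form.\<close>

definition eval_point :: "(('v::real_normed_vector \<Rightarrow>\<^sub>L real) \<Rightarrow> real) \<Rightarrow> 'v" where
  "eval_point F = (THE \<xi>. \<forall>\<nu>. F \<nu> = blinfun_apply \<nu> \<xi>)"

lemma eval_point:
  fixes F :: "('v::real_normed_vector \<Rightarrow>\<^sub>L real) \<Rightarrow> real"
  assumes "finite_dim TYPE('v)" and "linear F"
  shows "blinfun_apply \<nu> (eval_point F) = F \<nu>"
  using theI'[OF finite_dim_reflexive[OF assms]] unfolding eval_point_def by metis

lemma dual_gradient_eq_eval_point:
  "dual_gradient F \<mu> = eval_point (frechet_derivative F (at \<mu>))"
  by (simp add: dual_gradient_def eval_point_def)

section \<open>Differentials\<close>

lemma smooth_on_imp_differentiable: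
  assumes "smooth_on S f" "p \<in> S"
  shows "f differentiable (at p)"
proof -
  have "Ck_on (Suc 0) S f" using assms(1) unfolding smooth_on_def by blast
  with assms(2) show ?thesis by simp
qed

lemma Ck_on_const: "Ck_on k S (\<lambda>x. c)"
  by (induction k arbitrary: c) auto

text \<open>The derivative is \<open>f\<close> itself at every point, so each directional derivative
  is a constant function.\<close>

lemma smooth_on_bounded_linear:
  assumes "bounded_linear f"
  shows "smooth_on S f"
proof -
  have "frechet_derivative f (at x) = f" for x
    using assms by (metis bounded_linear_imp_has_derivative frechet_derivative_at)
  then have "Ck_on k S f" for k
    using assms bounded_linear_imp_differentiable[OF assms]
    by (cases k) (auto simp: Ck_on_const linear_continuous_on)
  then show ?thesis by (simp add: smooth_on_def)
qed

lemma blinfun_apply_differential: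
  assumes "f differentiable (at p)"
  shows "blinfun_apply (differential f p) = frechet_derivative f (at p)"
  unfolding differential_def
  using assms by (intro bounded_linear_Blinfun_apply)
    (simp add: frechet_derivative_works has_derivative_bounded_linear)

lemma has_derivative_differential:
  assumes "f differentiable (at p)"
  shows "(f has_derivative blinfun_apply (differential f p)) (at p)"
  using assms by (simp add: blinfun_apply_differential frechet_derivative_works)

text \<open>Every covector is thus the differential of a globally defined linear function, at any
  chosen point.\<close>

lemma differential_blinfun: "differential (blinfun_apply \<beta>) p = \<beta>"
proof -
  have "frechet_derivative (blinfun_apply \<beta>) (at p) = blinfun_apply \<beta>"
    by (metis blinfun.bounded_linear_right bounded_linear_imp_has_derivative frechet_derivative_at)
  then show ?thesis by (simp add: differential_def blinfun_apply_inverse)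
qed

section \<open>Components of covectors on the Lie-Poisson-Jacobi space\<close>

text \<open>The dual of \<open>lpj_space\<close> splits into the biduals of \<open>'g\<close> and
  \<open>'x\<close> and a copy of the reals. This component and \<open>alpha_part\<close> are moved
  from the bidual into \<open>'g\<close> and \<open>'x\<close> by \<open>eval_point\<close>.\<close>

definition mu_part :: "(('g::real_normed_vector, 'x::real_normed_vector) lpj_space \<Rightarrow>\<^sub>L real) \<Rightarrow> 'g" where
  "mu_part \<beta> = eval_point (\<lambda>\<nu>. blinfun_apply \<beta> (\<nu>, 0, 0))"

definition z_part :: "(('g::real_normed_vector, 'x::real_normed_vector) lpj_space \<Rightarrow>\<^sub>L real) \<Rightarrow> real" where
  "z_part \<beta> = blinfun_apply \<beta> (0, 1, 0)"

definition alpha_part :: "(('g::real_normed_vector, 'x::real_normed_vector) lpj_space \<Rightarrow>\<^sub>L real) \<Rightarrow> 'x" where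
  "alpha_part \<beta> = eval_point (\<lambda>a. blinfun_apply \<beta> (0, 0, a))"

text \<open>The chain rule along the three coordinate inclusions identifies each partial Frechet
  derivative with a restriction of the total differential. Hence the bracket sees \<open>f\<close>
  only through its value and its differential.\<close>

lemma partial_derivatives_differential:
  assumes f: "f differentiable (at p)"
  shows "d_mu f p = mu_part (differential f p)"
    and "d_z f p = z_part (differential f p)"
    and "d_alpha f p = alpha_part (differential f p)"
proof -
  obtain \<mu> z \<alpha> where p: "p = (\<mu>, z, \<alpha>)" by (cases p)
  note D = has_derivative_differential[OF f, unfolded p]
  have "((\<lambda>\<nu>. f (\<nu>, z, \<alpha>)) has_derivative
      (\<lambda>\<nu>. blinfun_apply (differential f p) (\<nu>, 0, 0))) (at \<mu>)"
    unfolding p by (rule has_derivative_compose[of "\<lambda>\<nu>. (\<nu>, z, \<alpha>)" _ _ _ f, OF _ D]) (intro has_derivative_Pair has_derivative_ident has_derivative_const)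
  from frechet_derivative_at[OF this] show "d_mu f p = mu_part (differential f p)"
    by (simp add: d_mu_def mu_part_def p dual_gradient_eq_eval_point)
  have "((\<lambda>a. f (\<mu>, z, a)) has_derivative
      (\<lambda>a. blinfun_apply (differential f p) (0, 0, a))) (at \<alpha>)"
    unfolding p by (rule has_derivative_compose[of "\<lambda>a. (\<mu>, z, a)" _ _ _ f, OF _ D]) (intro has_derivative_Pair has_derivative_ident has_derivative_const)
  from frechet_derivative_at[OF this] show "d_alpha f p = alpha_part (differential f p)"
    by (simp add: d_alpha_def alpha_part_def p dual_gradient_eq_eval_point)
  have "((\<lambda>s. f (\<mu>, s, \<alpha>)) has_derivative
      (\<lambda>s. blinfun_apply (differential f p) (0, s, 0))) (at z)"
    unfolding p by (rule has_derivative_compose[of "\<lambda>s. (\<mu>, s, \<alpha>)" _ _ _ f, OF _ D]) (intro has_derivative_Pair has_derivative_ident has_derivative_const)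
  \<comment> \<open>Homogeneity puts the derivative in the form of multiplication by a number, as a
    real derivative requires.\<close>
  moreover have "blinfun_apply (differential f p) (0, s, 0) = z_part (differential f p) * s" for s
    using blinfun.scaleR_right[of "differential f p" s "(0, 1, 0)"] by (simp add: z_part_def)
  ultimately have "((\<lambda>s. f (\<mu>, s, \<alpha>)) has_real_derivative z_part (differential f p)) (at z)"
    by (simp add: has_field_derivative_def)
  then show "d_z f p = z_part (differential f p)"
    by (simp add: d_z_def p DERIV_imp_deriv)
qed

lemma blinfun_mu_part:
  fixes \<beta> :: "('g::real_normed_vector, 'x::real_normed_vector) lpj_space \<Rightarrow>\<^sub>L real"
  assumes "finite_dim TYPE('g)"
  shows "blinfun_apply \<nu> (mu_part \<beta>) = blinfun_apply \<beta> (\<nu>, 0, 0)"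
  unfolding mu_part_def
proof (rule eval_point[OF assms])
  show "linear (\<lambda>\<nu>. blinfun_apply \<beta> (\<nu>, 0, 0))"
    by (intro bounded_linear.linear bounded_linear_compose[OF blinfun.bounded_linear_right]
      bounded_linear_Pair bounded_linear_ident bounded_linear_zero)
qed

lemma blinfun_alpha_part:
  fixes \<beta> :: "('g::real_normed_vector, 'x::real_normed_vector) lpj_space \<Rightarrow>\<^sub>L real"
  assumes "finite_dim TYPE('x)"
  shows "blinfun_apply a (alpha_part \<beta>) = blinfun_apply \<beta> (0, 0, a)"
  unfolding alpha_part_def
proof (rule eval_point[OF assms])
  show "linear (\<lambda>a. blinfun_apply \<beta> (0, 0, a))"
    by (intro bounded_linear.linear bounded_linear_compose[OF blinfun.bounded_linear_right]
      bounded_linear_Pair bounded_linear_ident bounded_linear_zero)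
qed

lemma lpj_covector_apply:
  fixes \<beta> :: "('g::real_normed_vector, 'x::real_normed_vector) lpj_space \<Rightarrow>\<^sub>L real"
  assumes "finite_dim TYPE('g)" "finite_dim TYPE('x)"
  shows "blinfun_apply \<beta> (\<nu>, s, a) =
    blinfun_apply \<nu> (mu_part \<beta>) + s * z_part \<beta> + blinfun_apply a (alpha_part \<beta>)"
proof -
  have "blinfun_apply \<beta> (\<nu>, s, a) = blinfun_apply \<beta> ((\<nu>, 0, 0) + s *\<^sub>R (0, 1, 0) + (0, 0, a))"
    by simp
  then show ?thesis
    using assms
    by (simp only: blinfun.add_right blinfun.scaleR_right blinfun_mu_part blinfun_alpha_part z_part_def) simp
qed

lemma linear_mu_part:
  assumes "finite_dim TYPE('g)"
  shows "linear (mu_part :: (('g::real_normed_vector, 'x::real_normed_vector) lpj_space \<Rightarrow>\<^sub>L real) \<Rightarrow> 'g)"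
  by (rule linearI; rule finite_dim_dual_separates[OF assms])
    (simp_all add: blinfun_mu_part[OF assms] blinfun.add_right blinfun.add_left
      blinfun.scaleR_right blinfun.scaleR_left)

lemma linear_alpha_part:
  assumes "finite_dim TYPE('x)"
  shows "linear (alpha_part :: (('g::real_normed_vector, 'x::real_normed_vector) lpj_space \<Rightarrow>\<^sub>L real) \<Rightarrow> 'x)"
  by (rule linearI; rule finite_dim_dual_separates[OF assms])
    (simp_all add: blinfun_alpha_part[OF assms] blinfun.add_right blinfun.add_left
      blinfun.scaleR_right blinfun.scaleR_left)

lemma linear_z_part: "linear z_part"
  by (rule linearI) (simp_all add: z_part_def blinfun.add_left blinfun.scaleR_left)

text \<open>Two of the factors are themselves dual spaces, so evaluation at vectors of
  \<open>'g\<close> and \<open>'x\<close>, together with the projection to \<open>z\<close>,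
  supplies enough functionals.\<close>

lemma lpj_space_dual_separates:
  fixes v w :: "('g::real_normed_vector, 'x::real_normed_vector) lpj_space"
  assumes eq: "\<And>\<beta> :: ('g, 'x) lpj_space \<Rightarrow>\<^sub>L real. blinfun_apply \<beta> v = blinfun_apply \<beta> w"
  shows "v = w"
proof -
  obtain \<mu> z \<alpha> \<mu>' z' \<alpha>' where vw: "v = (\<mu>, z, \<alpha>)" "w = (\<mu>', z', \<alpha>')"
    by (cases v, cases w)
  have *: "F v = F w" if "bounded_linear F" for F :: "('g, 'x) lpj_space \<Rightarrow> real"
    using eq[of "Blinfun F"] that by (simp add: bounded_linear_Blinfun_apply)
  have "\<mu> = \<mu>'"
  proof (rule blinfun_eqI)
    fix \<xi>
    have "bounded_linear (\<lambda>q :: ('g, 'x) lpj_space. blinfun_apply (fst q) \<xi>)"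
      by (intro bounded_linear_intros)
    from *[OF this] show "blinfun_apply \<mu> \<xi> = blinfun_apply \<mu>' \<xi>" by (simp add: vw)
  qed
  moreover have "\<alpha> = \<alpha>'"
  proof (rule blinfun_eqI)
    fix x
    have "bounded_linear (\<lambda>q :: ('g, 'x) lpj_space. blinfun_apply (snd (snd q)) x)"
      by (intro bounded_linear_intros)
    from *[OF this] show "blinfun_apply \<alpha> x = blinfun_apply \<alpha>' x" by (simp add: vw)
  qed
  moreover have "bounded_linear (\<lambda>q :: ('g, 'x) lpj_space. fst (snd q))"
    by (intro bounded_linear_intros)
  from *[OF this] have "z = z'" by (simp add: vw)
  ultimately show ?thesis by (simp add: vw)
qed

section \<open>The Lie algebra and its representation\<close>

lemma vector_fields_linear:
  assumes D: "D \<in> vector_fields T A" and "f \<in> smooth_functions T A" "g \<in> smooth_functions T A"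
  shows "D (\<lambda>p. a * f p + b * g p) = (\<lambda>p. a * D f p + b * D g p)"
  using assms unfolding vector_fields_def by blast

text \<open>Either the zero function is smooth and linearity applies, or the convention for
  non-smooth arguments gives the value.\<close>

lemma vector_fields_zero:
  assumes "D \<in> vector_fields T A"
  shows "D (\<lambda>p. 0) = (\<lambda>p. 0)"
proof (cases "(\<lambda>p. 0) \<in> smooth_functions T A")
  case True
  from vector_fields_linear[OF assms True True, of 0 0] show ?thesis by simp
next
  case False
  with assms show ?thesis unfolding vector_fields_def by blast
qed

text \<open>For a non-smooth \<open>f\<close> all the values vanish by convention, so no smoothness is needed.\<close>

lemma vector_fields_linear_values:
  assumes D: "D \<in> vector_fields T A" and D1: "D1 \<in> vector_fields T A" and D2: "D2 \<in> vector_fields T A"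
  shows "D (\<lambda>p. a * D1 f p + b * D2 f p) = (\<lambda>p. a * D (D1 f) p + b * D (D2 f) p)"
proof (cases "f \<in> smooth_functions T A")
  case True
  then have "D1 f \<in> smooth_functions T A" "D2 f \<in> smooth_functions T A"
    using D1 D2 unfolding vector_fields_def by blast+
  with D show ?thesis by (rule vector_fields_linear)
next
  case False
  then have "D1 f = (\<lambda>p. 0)" "D2 f = (\<lambda>p. 0)"
    using D1 D2 unfolding vector_fields_def by blast+
  then show ?thesis using vector_fields_zero[OF D] by simp
qed

text \<open>\<open>lie_algebra_of\<close> imposes no algebraic law on \<open>lb\<close> directly.
  Injectivity of \<open>\<Xi>\<close> transfers skewness and linearity from the commutator of
  derivations.\<close>

lemma lie_algebra_of_bracket:
  fixes lb :: "'g::real_normed_vector \<Rightarrow> 'g \<Rightarrow> 'g"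
  assumes la: "lie_algebra_of G T A lb \<Xi>"
  shows "bilinear lb" and "lb \<xi> \<eta> = - lb \<eta> \<xi>"
proof -
  have inj: "\<xi> = \<eta>" if "\<Xi> \<xi> = \<Xi> \<eta>" for \<xi> \<eta>
    using la that unfolding lie_algebra_of_def bij_betw_def inj_on_def by blast
  have lin: "\<Xi> (a *\<^sub>R \<xi> + b *\<^sub>R \<eta>) f p = a * \<Xi> \<xi> f p + b * \<Xi> \<eta> f p" for a b \<xi> \<eta> f p
    using la unfolding lie_algebra_of_def by blast
  have br: "\<Xi> (lb \<xi> \<eta>) = vf_commutator (\<Xi> \<xi>) (\<Xi> \<eta>)" for \<xi> \<eta>
    using la unfolding lie_algebra_of_def by blast
  have vf: "\<Xi> \<xi> \<in> vector_fields T A" for \<xi>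
    using la unfolding lie_algebra_of_def bij_betw_def left_invariant_fields_def by blast
  have skew: "lb \<xi> \<eta> = - lb \<eta> \<xi>" for \<xi> \<eta>
  proof (rule inj, intro ext)
    fix f p
    show "\<Xi> (lb \<xi> \<eta>) f p = \<Xi> (- lb \<eta> \<xi>) f p"
      using lin[of "-1" "lb \<eta> \<xi>" 0 0 f p] by (simp add: br vf_commutator_def)
  qed
  have left: "lb (a *\<^sub>R \<xi> + b *\<^sub>R \<eta>) \<zeta> = a *\<^sub>R lb \<xi> \<zeta> + b *\<^sub>R lb \<eta> \<zeta>" for a b \<xi> \<eta> \<zeta>
  proof (rule inj, intro ext)
    fix f p
    \<comment> \<open>The combination is first expanded inside the argument of
      \<open>\<Xi> \<zeta>\<close>; only then can linearity of that derivation be used.\<close>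
    have "\<Xi> \<zeta> (\<Xi> (a *\<^sub>R \<xi> + b *\<^sub>R \<eta>) f) = \<Xi> \<zeta> (\<lambda>p. a * \<Xi> \<xi> f p + b * \<Xi> \<eta> f p)"
      by (rule arg_cong[of _ _ "\<Xi> \<zeta>"]) (simp add: lin fun_eq_iff)
    then show "\<Xi> (lb (a *\<^sub>R \<xi> + b *\<^sub>R \<eta>) \<zeta>) f p = \<Xi> (a *\<^sub>R lb \<xi> \<zeta> + b *\<^sub>R lb \<eta> \<zeta>) f p"
      by (simp add: br lin vf_commutator_def vector_fields_linear_values[OF vf vf vf] algebra_simps)
  qed
  have right: "lb \<zeta> (a *\<^sub>R \<xi> + b *\<^sub>R \<eta>) = a *\<^sub>R lb \<zeta> \<xi> + b *\<^sub>R lb \<zeta> \<eta>" for a b \<xi> \<eta> \<zeta>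
    using left[of a \<xi> b \<eta> \<zeta>] by (simp add: skew[of \<zeta>])
  show "bilinear lb"
    unfolding bilinear_def
  proof (intro conjI allI linearI)
    show "lb x (y + z) = lb x y + lb x z" for x y z using right[of x 1 y 1 z] by simp
    show "lb x (r *\<^sub>R y) = r *\<^sub>R lb x y" for r x y using right[of x r y 0 0] by simp
    show "lb (y + z) x = lb y x + lb z x" for x y z using left[of 1 y 1 z x] by simp
    show "lb (r *\<^sub>R y) x = r *\<^sub>R lb y x" for r x y using left[of r y 0 0 x] by simp
  qed
  show "lb \<xi> \<eta> = - lb \<eta> \<xi>" by (rule skew)
qed

text \<open>Two operators agree once every functional \<open>e\<close> sending \<open>B\<close> to
  \<open>\<nu> (B x)\<close> agrees on them. On such an \<open>e\<close> the definition of
  \<open>\<rho>'\<close> reduces the claim to linearity of \<open>\<Xi>\<close>.\<close>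

lemma infinitesimal_representation_linear:
  fixes \<rho>' :: "'g::real_normed_vector \<Rightarrow> ('x::real_normed_vector \<Rightarrow>\<^sub>L 'x)"
  assumes la: "lie_algebra_of G T A lb \<Xi>" and fin: "finite_dim TYPE('x)"
    and inf: "infinitesimal_representation G \<Xi> \<rho> \<rho>'"
  shows "linear \<rho>'"
proof -
  have lin: "\<Xi> (a *\<^sub>R \<xi> + b *\<^sub>R \<eta>) f p = a * \<Xi> \<xi> f p + b * \<Xi> \<eta> f p" for a b \<xi> \<eta> f p
    using la unfolding lie_algebra_of_def by blast
  have comb: "\<rho>' (a *\<^sub>R \<xi> + b *\<^sub>R \<eta>) = a *\<^sub>R \<rho>' \<xi> + b *\<^sub>R \<rho>' \<eta>" for a b \<xi> \<eta>
  proof (rule blinfun_eqI, rule finite_dim_dual_separates[OF fin])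
    fix x and \<nu> :: "'x \<Rightarrow>\<^sub>L real"
    define e where "e = Blinfun (\<lambda>B :: 'x \<Rightarrow>\<^sub>L 'x. blinfun_apply \<nu> (blinfun_apply B x))"
    have "bounded_linear (\<lambda>B :: 'x \<Rightarrow>\<^sub>L 'x. blinfun_apply \<nu> (blinfun_apply B x))"
      by (intro bounded_linear_intros)
    then have e: "blinfun_apply e B = blinfun_apply \<nu> (blinfun_apply B x)" for B
      by (simp add: e_def bounded_linear_Blinfun_apply)
    have "blinfun_apply e (\<rho>' (a *\<^sub>R \<xi> + b *\<^sub>R \<eta>)) = blinfun_apply e (a *\<^sub>R \<rho>' \<xi> + b *\<^sub>R \<rho>' \<eta>)"
      using inf unfolding infinitesimal_representation_def
      by (simp add: lin blinfun.add_right blinfun.scaleR_right)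
    then show "blinfun_apply \<nu> (blinfun_apply (\<rho>' (a *\<^sub>R \<xi> + b *\<^sub>R \<eta>)) x) =
        blinfun_apply \<nu> (blinfun_apply (a *\<^sub>R \<rho>' \<xi> + b *\<^sub>R \<rho>' \<eta>) x)"
      by (simp add: e)
  qed
  show ?thesis
  proof (rule linearI)
    show "\<rho>' (x + y) = \<rho>' x + \<rho>' y" for x y using comb[of 1 x 1 y] by simp
    show "\<rho>' (r *\<^sub>R x) = r *\<^sub>R \<rho>' x" for r x using comb[of r x 0 0] by simp
  qed
qed

section \<open>The Hamiltonian vector field\<close>

text \<open>The bracket without its terms in the undifferentiated \<open>f\<close> and
  \<open>g\<close>. Since \<open>E\<close> is minus the \<open>z\<close>-derivative, those terms are
  exactly f E(g) - g E(f).\<close>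

definition lpj_bivector ::
  "('g::real_normed_vector \<Rightarrow> 'g \<Rightarrow> 'g) \<Rightarrow> ('g \<Rightarrow> ('x::real_normed_vector \<Rightarrow>\<^sub>L 'x)) \<Rightarrow>
   ('g, 'x) lpj_space \<Rightarrow> (('g, 'x) lpj_space \<Rightarrow>\<^sub>L real) \<Rightarrow> (('g, 'x) lpj_space \<Rightarrow>\<^sub>L real) \<Rightarrow> real" where
  "lpj_bivector lb \<rho>' = (\<lambda>(\<mu>, z, \<alpha>) \<beta> \<gamma>.
     blinfun_apply \<mu> (lb (mu_part \<beta>) (mu_part \<gamma>))
     + blinfun_apply \<mu> (mu_part \<beta>) * z_part \<gamma>
     - blinfun_apply \<mu> (mu_part \<gamma>) * z_part \<beta>
     + blinfun_apply \<alpha> (blinfun_apply (\<rho>' (mu_part \<beta>)) (alpha_part \<gamma>)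
                        - blinfun_apply (\<rho>' (mu_part \<gamma>)) (alpha_part \<beta>)))"

text \<open>Testing the bracket on the linear functions \<beta> and \<gamma>, whose differentials
  are \<beta> and \<gamma> everywhere, determines the value of the bivector on them.\<close>

lemma is_jacobi_bivector_unique:
  fixes br :: "('p::real_normed_vector \<Rightarrow> real) \<Rightarrow> ('p \<Rightarrow> real) \<Rightarrow> 'p \<Rightarrow> real"
  assumes "is_jacobi_bivector br E \<Lambda>" "is_jacobi_bivector br E \<Lambda>'"
  shows "\<Lambda> = \<Lambda>'"
proof (intro ext)
  fix p and \<beta> \<gamma> :: "'p \<Rightarrow>\<^sub>L real"
  have "smooth_on UNIV (blinfun_apply \<beta>)" "smooth_on UNIV (blinfun_apply \<gamma>)"
    by (auto intro: smooth_on_bounded_linear blinfun.bounded_linear_right)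
  then have "br (blinfun_apply \<beta>) (blinfun_apply \<gamma>) p = M p \<beta> \<gamma>
      + blinfun_apply \<beta> p * blinfun_apply \<gamma> (E p) - blinfun_apply \<gamma> p * blinfun_apply \<beta> (E p)"
    if "is_jacobi_bivector br E M" for M
    using that unfolding is_jacobi_bivector_def by (metis differential_blinfun)
  from this[OF assms(1)] this[OF assms(2)] show "\<Lambda> p \<beta> \<gamma> = \<Lambda>' p \<beta> \<gamma>"
    by simp
qed

text \<open>Isolates the algebra extracted from the group and its representation.\<close>

locale lie_poisson_jacobi =
  fixes lb :: "'g::real_normed_vector \<Rightarrow> 'g \<Rightarrow> 'g"
    and \<rho>' :: "'g \<Rightarrow> ('x::real_normed_vector \<Rightarrow>\<^sub>L 'x)"
  assumes fin_g: "finite_dim TYPE('g)" and fin_x: "finite_dim TYPE('x)"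
    and bilinear_lb: "bilinear lb" and lb_skew: "lb \<xi> \<eta> = - lb \<eta> \<xi>"
    and linear_rho: "linear \<rho>'"
begin

lemma is_jacobi_bivector_lpj:
  "is_jacobi_bivector (lpj_bracket lb \<rho>') lpj_E (lpj_bivector lb \<rho>')"
  unfolding is_jacobi_bivector_def
proof (intro conjI allI impI)
  fix p :: "('g, 'x) lpj_space"
  obtain \<mu> z \<alpha> where p: "p = (\<mu>, z, \<alpha>)" by (cases p)
  note linear = linear_add[OF linear_mu_part[OF fin_g]] linear_scale[OF linear_mu_part[OF fin_g]]
    linear_add[OF linear_alpha_part[OF fin_x]] linear_scale[OF linear_alpha_part[OF fin_x]]
    linear_add[OF linear_z_part] linear_scale[OF linear_z_part]
    linear_add[OF linear_rho] linear_scale[OF linear_rho]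
    bilinear_ladd[OF bilinear_lb] bilinear_lmul[OF bilinear_lb]
    bilinear_radd[OF bilinear_lb] bilinear_rmul[OF bilinear_lb]
  show skew: "lpj_bivector lb \<rho>' p \<beta> \<gamma> = - lpj_bivector lb \<rho>' p \<gamma> \<beta>" for \<beta> \<gamma>
    unfolding p lpj_bivector_def
    by (subst lb_skew) (simp add: blinfun.minus_right blinfun.diff_right)
  have right: "linear (\<lambda>\<gamma>. lpj_bivector lb \<rho>' p \<beta> \<gamma>)" for \<beta>
    by (rule linearI) (simp_all add: p lpj_bivector_def linear blinfun.add_right blinfun.scaleR_right
      blinfun.diff_right blinfun.add_left blinfun.scaleR_left algebra_simps)
  show "bilinear (lpj_bivector lb \<rho>' p)"
    unfolding bilinear_def
  proof (intro conjI allI right)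
    show "linear (\<lambda>\<beta>. lpj_bivector lb \<rho>' p \<beta> \<gamma>)" for \<gamma>
      \<comment> \<open>Skewness turns linearity in the second argument into linearity in the
        first.\<close>
      by (subst skew) (intro linear_compose_neg right)
  qed
  fix f g :: "('g, 'x) lpj_space \<Rightarrow> real"
  assume "smooth_on UNIV f" "smooth_on UNIV g"
  then have "f differentiable (at p)" "g differentiable (at p)"
    by (auto intro: smooth_on_imp_differentiable)
  note partials = this[THEN partial_derivatives_differential(1)]
    this[THEN partial_derivatives_differential(2)] this[THEN partial_derivatives_differential(3)]
  have E: "blinfun_apply \<beta> (lpj_E p) = - z_part \<beta>" for \<beta> :: "('g, 'x) lpj_space \<Rightarrow>\<^sub>L real"
    using blinfun.minus_right[of \<beta> "(0, 1, 0)"] by (simp add: lpj_E_def z_part_def)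
  show "lpj_bracket lb \<rho>' f g p = lpj_bivector lb \<rho>' p (differential f p) (differential g p)
      + f p * blinfun_apply (differential g p) (lpj_E p)
      - g p * blinfun_apply (differential f p) (lpj_E p)"
    unfolding E
    using partials by (simp add: p lpj_bracket_def lpj_bivector_def Let_def algebra_simps)
qed

lemma jacobi_bivector_lpj:
  "jacobi_bivector (lpj_bracket lb \<rho>') lpj_E = lpj_bivector lb \<rho>'"
  unfolding jacobi_bivector_def
  using is_jacobi_bivector_lpj is_jacobi_bivector_unique by (intro the_equality) blast+

section \<open>The explicit Hamiltonian vector field and its integral curves\<close>

text \<open>\<open>Blinfun\<close> returns the intended functional only for bounded linear maps;
  automatic continuity on \<open>'g\<close> provides this here and in
  \<open>J_map_apply\<close>.\<close>

lemma ad_star_apply: "blinfun_apply (ad_star lb \<xi> \<mu>) \<eta> = blinfun_apply \<mu> (lb \<xi> \<eta>)"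
proof -
  have "linear (\<lambda>\<eta>. blinfun_apply \<mu> (lb \<xi> \<eta>))"
    by (rule linearI) (simp_all add: bilinear_radd[OF bilinear_lb] bilinear_rmul[OF bilinear_lb]
      blinfun.add_right blinfun.scaleR_right)
  from finite_dim_linear_imp_bounded_linear[OF fin_g this] show ?thesis
    by (simp add: ad_star_def bounded_linear_Blinfun_apply)
qed

lemma J_map_apply: "blinfun_apply (J_map \<rho>' x \<alpha>) \<eta> = blinfun_apply \<alpha> (blinfun_apply (\<rho>' \<eta>) x)"
proof -
  have "linear (\<lambda>\<eta>. blinfun_apply \<alpha> (blinfun_apply (\<rho>' \<eta>) x))"
    by (rule linearI) (simp_all add: linear_add[OF linear_rho] linear_scale[OF linear_rho]
      blinfun.add_right blinfun.scaleR_right blinfun.add_left blinfun.scaleR_left)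
  from finite_dim_linear_imp_bounded_linear[OF fin_g this] show ?thesis
    by (simp add: J_map_def bounded_linear_Blinfun_apply)
qed

text \<open>In the pairing with a covector \<beta>, the coefficients of
  \<open>mu_part \<beta>\<close>, \<open>z_part \<beta>\<close> and
  \<open>alpha_part \<beta>\<close> are the three components. The term \<open>h E\<close>
  contributes \<open>- h p\<close> to the \<open>z\<close> component, and the minus sign in
  \<open>rho_star\<close> accounts for the sign of the last one.\<close>

lemma hamiltonian_vector_field_lpj:
  assumes h: "h differentiable (at p)" and p: "p = (\<mu>, z, \<alpha>)"
  shows "hamiltonian_vector_field (lpj_bracket lb \<rho>') lpj_E h p =
    (ad_star lb (d_mu h p) \<mu> - d_z h p *\<^sub>R \<mu> - J_map \<rho>' (d_alpha h p) \<alpha>,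
     blinfun_apply \<mu> (d_mu h p) - h p,
     - rho_star \<rho>' (d_mu h p) \<alpha>)" (is "_ = ?v")
proof -
  have "blinfun_apply \<beta> ?v =
    jacobi_bivector (lpj_bracket lb \<rho>') lpj_E p (differential h p) \<beta> + h p * blinfun_apply \<beta> (lpj_E p)"
    for \<beta>
    by (simp add: jacobi_bivector_lpj partial_derivatives_differential[OF h, unfolded p] lpj_E_def
      lpj_covector_apply[OF fin_g fin_x] lpj_bivector_def p ad_star_apply J_map_apply rho_star_def
      blinfun.add_left blinfun.diff_left blinfun.scaleR_left blinfun.diff_right algebra_simps)
  then show ?thesis
    unfolding hamiltonian_vector_field_def
    \<comment> \<open>Separation of points by covectors gives the uniqueness behind the definite
      description.\<close>
    by (intro the_equality allI lpj_space_dual_separates) simp_all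
qed

end

text \<open>Differentiability of the components is recovered by the bounded linear projections.
  Applied twice, this splits the curve equation into its three components.\<close>

lemma has_vector_derivative_Pair_iff:
  "((\<lambda>t. (f t, g t)) has_vector_derivative (u, v)) (at t within S) \<longleftrightarrow>
   (f has_vector_derivative u) (at t within S) \<and> (g has_vector_derivative v) (at t within S)"
  using bounded_linear.has_vector_derivative[OF bounded_linear_fst, of "\<lambda>t. (f t, g t)" "(u, v)" "at t within S"]
    bounded_linear.has_vector_derivative[OF bounded_linear_snd, of "\<lambda>t. (f t, g t)" "(u, v)" "at t within S"]
  by (auto intro: has_vector_derivative_Pair)

theorem proposition6p3:
  fixes G :: "('m, 'b) monoid_scheme"
    and T :: "'m topology"
    and A :: "('m, 'e::real_normed_vector) chart set"
    and lb :: "'g::real_normed_vector \<Rightarrow> 'g \<Rightarrow> 'g"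
    and \<Xi> :: "'g \<Rightarrow> ('m \<Rightarrow> real) \<Rightarrow> ('m \<Rightarrow> real)"
    and \<rho> :: "'m \<Rightarrow> ('x::real_normed_vector \<Rightarrow>\<^sub>L 'x)"
    and \<rho>' :: "'g \<Rightarrow> ('x \<Rightarrow>\<^sub>L 'x)"
    and h :: "('g, 'x) lpj_space \<Rightarrow> real"
    and I :: "real set"
    and \<mu> :: "real \<Rightarrow> ('g \<Rightarrow>\<^sub>L real)" and z :: "real \<Rightarrow> real" and \<alpha> :: "real \<Rightarrow> ('x \<Rightarrow>\<^sub>L real)"
  assumes "lie_group G T A"
    and "lie_algebra_of G T A lb \<Xi>"
    and "finite_dim TYPE('x)"
    and "lie_group_representation G T A \<rho>"
    and "infinitesimal_representation G \<Xi> \<rho> \<rho>'"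
    and "smooth_on UNIV h"
    and "open I" and "is_interval I"
  shows "is_integral_curve (hamiltonian_vector_field (lpj_bracket lb \<rho>') lpj_E h) I
           (\<lambda>t. (\<mu> t, z t, \<alpha> t)) \<longleftrightarrow>
         (\<forall>t\<in>I. let p = (\<mu> t, z t, \<alpha> t) in
            (\<mu> has_vector_derivative
               ad_star lb (d_mu h p) (\<mu> t) - d_z h p *\<^sub>R \<mu> t - J_map \<rho>' (d_alpha h p) (\<alpha> t)) (at t) \<and>
            (z has_real_derivative
               blinfun_apply (\<mu> t) (d_mu h p) - h p) (at t) \<and>
            (\<alpha> has_vector_derivative
               - rho_star \<rho>' (d_mu h p) (\<alpha> t)) (at t))"
proof -
  \<comment> \<open>The group and its representation enter through this interpretation.\<close>
  interpret lie_poisson_jacobi lb \<rho>'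
  proof (rule lie_poisson_jacobi.intro)
    show "finite_dim TYPE('g)" using assms(2) unfolding lie_algebra_of_def by blast
    show "finite_dim TYPE('x)" by fact
    show "bilinear lb" "lb \<xi> \<eta> = - lb \<eta> \<xi>" for \<xi> \<eta>
      using lie_algebra_of_bracket[OF assms(2)] by blast+
    show "linear \<rho>'" using assms(2,3,5) by (rule infinitesimal_representation_linear)
  qed
  have "h differentiable (at p)" for p
    using assms(6) by (auto intro: smooth_on_imp_differentiable)
  \<comment> \<open>Both sides are conditions at each \<open>t\<close> in \<open>I\<close>;
    inserting the explicit field and splitting the triple makes them identical.\<close>
  then show ?thesis
    by (simp add: is_integral_curve_def hamiltonian_vector_field_lpj[OF _ refl]
      has_vector_derivative_Pair_iff has_real_derivative_iff_has_vector_derivative Let_def)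
qed

end
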